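(* Let $k$ and $s$ be positive integers with $s\in\{\lceil k/2\rceil,\ldots,k\}$, and for $n\ge 1$ let $b_n^{(k,s)}$ be the number of vertices of $P_{n,k,s}$. Then, as formal power series, $$1+\sum_{n\geq 1} b^{(k,s)}_{n} x^n=\frac{1}{1-kx+(k-s)(k-s-1)x^2}.$$ The sequence satisfies the recurrence $b_{n+2}^{(k,s)}-k\,b_{n+1}^{(k,s)}+(k-s)(k-s-1)\,b_n^{(k,s)}=0$ for $n\ge 2$, with initial values $b_1^{(k,s)}=k$ and $b_2^{(k,s)}=k^2-(k-s)(k-s-1)$. Moreover, for all $n\geq 1$, $$b_n^{(k,s)}=\frac{1}{2^{n+1}}\left(w_-^n+w_+^n+\frac{2k}{w_+-w_-}\left(w_+^n-w_-^n\right)\right),$$ where $w_{+}=k+\sqrt{k^2-4(k-s)(k-s-1)}$ and $w_-=k-\sqrt{k^2-4(k-s)(k-s-1)}$.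
   Context: For positive integers $n,k,s$ let $K=s(n-1)+k$ and let $e_0,\ldots,e_{K-1}$ be the standard basis of $\mathbb{R}^{K}$. For $0\le i\le n-1$ let $\lambda_i=\{si,si+1,\ldots,si+k-1\}$ and $\Delta_{\lambda_i}=\operatorname{conv}\{e_j: j\in\lambda_i\}$. Then $P_{n,k,s}=\sum_{i=0}^{n-1}\Delta_{\lambda_i}$ (Minkowski sum). *)

theory Defs
  imports
    "HOL-Analysis.Analysis"
    "HOL-Analysis.Finite_Function_Topology"
    "HOL-Computational_Algebra.Formal_Power_Series"
begin

text \<open>
  The dimension \<open>K = s (n - 1) + k\<close> varies with \<open>n\<close>, so \<open>\<real>\<^sup>K\<close> is realised as the span of
  \<open>e\<^sub>0, \<dots>, e\<^bsub>K - 1\<^esub>\<close> in the space of finitely supported real sequences. Convex hulls, Minkowski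
  sums and extreme points do not depend on the ambient space.
\<close>

definition std_basis :: "nat \<Rightarrow> (nat \<Rightarrow>\<^sub>0 real)" where
  "std_basis j = Poly_Mapping.single j 1"

definition ambient :: "nat \<Rightarrow> (nat \<Rightarrow>\<^sub>0 real) set" where
  "ambient K = span (std_basis ` {..<K})"

definition lam_set :: "nat \<Rightarrow> nat \<Rightarrow> nat \<Rightarrow> nat set" where
  "lam_set k s i = {s * i ..< s * i + k}"

definition simplex_on :: "nat set \<Rightarrow> (nat \<Rightarrow>\<^sub>0 real) set" where
  "simplex_on I = convex hull (std_basis ` I)"

text \<open>The sum below is the Minkowski sum (pointwise addition of sets).\<close>

definition minkowski_polytope :: "nat \<Rightarrow> nat \<Rightarrow> nat \<Rightarrow> (nat \<Rightarrow>\<^sub>0 real) set" where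
  "minkowski_polytope n k s = (\<Sum>i<n. simplex_on (lam_set k s i))"

definition vertices :: "'a::real_vector set \<Rightarrow> 'a set" where
  "vertices S = {v. v extreme_point_of S}"

definition num_vertices :: "nat \<Rightarrow> nat \<Rightarrow> nat \<Rightarrow> nat" where
  "num_vertices k s n = card (vertices (minkowski_polytope n k s))"

lemma subspace_set_sum:
  fixes A :: "nat \<Rightarrow> 'a::real_vector set"
  assumes "subspace V" and "\<And>i. i < n \<Longrightarrow> A i \<subseteq> V"
  shows "(\<Sum>i<n. A i) \<subseteq> V"
  using assms(2)
proof (induction n)
  case 0
  then show ?case using assms(1) by (simp add: subspace_0)
next
  case (Suc n)
  then have "(\<Sum>i<n. A i) \<subseteq> V" and "A n \<subseteq> V" by auto
  then show ?case
    using assms(1) by (auto simp: set_plus_def intro: subspace_add)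
qed

lemma minkowski_polytope_subset_ambient: "minkowski_polytope n k s \<subseteq> ambient (s * (n - 1) + k)"
  unfolding minkowski_polytope_def
proof (rule subspace_set_sum)
  show "subspace (ambient (s * (n - 1) + k))"
    by (simp add: ambient_def)
next
  fix i assume "i < n"
  then have "s * i \<le> s * (n - 1)" by (intro mult_le_mono2) linarith
  then have "lam_set k s i \<subseteq> {..<s * (n - 1) + k}" unfolding lam_set_def by (intro subsetI, unfold atLeastLessThan_iff lessThan_iff, linarith)
  then have "std_basis ` lam_set k s i \<subseteq> ambient (s * (n - 1) + k)"
    unfolding ambient_def by (meson image_mono order_trans span_superset)
  then show "simplex_on (lam_set k s i) \<subseteq> ambient (s * (n - 1) + k)"
    unfolding simplex_on_def ambient_def
    by (simp add: hull_minimal subspace_imp_convex)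
qed

end

theory Submission
  imports Defs
begin

text \<open>
  A vertex of the polytope is a sum of unit vectors \<open>e\<^bsub>c(i)\<^esub>\<close> for a choice of \<open>c(i) \<in> \<lambda>\<^sub>i\<close>. If for
  some \<open>i\<close> the values \<open>c(i) \<noteq> c(i+1)\<close> both lie in \<open>\<lambda>\<^sub>i \<inter> \<lambda>\<^bsub>i+1\<^esub>\<close>, then the sum is the midpoint of two
  others and not a vertex. Otherwise, because \<open>s \<ge> k/2\<close> makes \<open>\<lambda>\<^sub>i\<close> and \<open>\<lambda>\<^bsub>i+2\<^esub>\<close> disjoint, there are weights
  on the coordinates for which each \<open>c(i)\<close> is the strict maximum on \<open>\<lambda>\<^sub>i\<close>, so distinct such choices
  give distinct vertices. Of the \<open>k b\<^bsub>n+1\<^esub>\<close> one-step extensions of the admissible choices, those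
  spoiled at the last step are an arbitrary admissible choice of length \<open>n\<close> followed by an ordered
  pair of distinct elements of a set of size \<open>k - s\<close>, whence the recurrence.
\<close>

subsection \<open>Vertices of Minkowski sums of coordinate simplices\<close>

lemma lookup_scaleR_poly_mapping:
  fixes x :: "'a \<Rightarrow>\<^sub>0 'b::real_vector"
  shows "Poly_Mapping.lookup (r *\<^sub>R x) i = r *\<^sub>R Poly_Mapping.lookup x i"
proof -
  have "finite {i. r *\<^sub>R Poly_Mapping.lookup x i \<noteq> 0}"
    by (rule finite_subset[OF _ finite_lookup[of x]]) auto
  then show ?thesis by (simp add: scaleR_poly_mapping_def Abs_poly_mapping_inverse)
qed

text \<open>Summing over a fixed set \<open>A\<close> rather than over the support of
  \<open>v\<close> makes linearity immediate.\<close>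

definition weight_functional :: "nat set \<Rightarrow> (nat \<Rightarrow> real) \<Rightarrow> (nat \<Rightarrow>\<^sub>0 real) \<Rightarrow> real" where
  "weight_functional A w v = (\<Sum>j\<in>A. w j * Poly_Mapping.lookup v j)"

lemma linear_weight_functional: "linear (weight_functional A w)"
  by (rule linearI)
    (simp_all add: weight_functional_def lookup_add lookup_scaleR_poly_mapping algebra_simps
      sum.distrib sum_distrib_left)

lemma weight_functional_std_basis:
  assumes "finite A" "j \<in> A"
  shows "weight_functional A w (std_basis j) = w j"
  using assms by (simp add: weight_functional_def std_basis_def lookup_single when_def mult_if_delta
    if_distrib[of "(*) (w _)"] cong: if_cong)

lemma std_basis_eq_iff [simp]: "std_basis i = std_basis j \<longleftrightarrow> i = j"
  by (metis std_basis_def lookup_single_eq lookup_single_not_eq one_neq_zero)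

text \<open>The point \<open>x\<close> together with the open half-space below its level is convex,
  so it contains the hull. A proper convex combination of two distinct points of it lies strictly
  below the level of \<open>x\<close>.\<close>

lemma strict_max_extreme_point_of_convex_hull:
  fixes \<phi> :: "'a::real_vector \<Rightarrow> real"
  assumes \<phi>: "linear \<phi>" and x: "x \<in> S"
    and max: "\<And>y. y \<in> S \<Longrightarrow> y \<noteq> x \<Longrightarrow> \<phi> y < \<phi> x"
  shows "x extreme_point_of (convex hull S)"
proof -
  interpret linear \<phi> by (fact \<phi>)
  let ?H = "{y. y = x \<or> \<phi> y < \<phi> x}"
  have conv_le: "u * \<phi> a + v * \<phi> b < \<phi> x"
    if "u > 0" "v > 0" "u + v = 1" "\<phi> a \<le> \<phi> x" "\<phi> b \<le> \<phi> x" "\<phi> a < \<phi> x \<or> \<phi> b < \<phi> x" for u v a b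
  proof -
    have "u * \<phi> a + v * \<phi> b < u * \<phi> x + v * \<phi> x"
      using that by (metis add_less_le_mono add_le_less_mono mult_less_cancel_left_pos mult_le_cancel_left_pos)
    then show ?thesis using that by (metis distrib_right mult_1)
  qed
  have "convex ?H"
    unfolding convex_alt
  proof (intro ballI allI impI)
    fix a b and u :: real
    assume a: "a \<in> ?H" and b: "b \<in> ?H" and u: "0 \<le> u \<and> u \<le> 1"
    consider "u = 0" | "u = 1" | "a = x" "b = x" | "0 < u" "u < 1" "a \<noteq> x \<or> b \<noteq> x"
      using u by linarith
    then show "(1 - u) *\<^sub>R a + u *\<^sub>R b \<in> ?H"
    proof cases
      case 3
      then show ?thesis by (simp flip: scaleR_left_distrib)
    next
      case 4
      have "(1 - u) * \<phi> a + u * \<phi> b < \<phi> x"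
        using 4 a b by (intro conv_le) auto
      then show ?thesis by (simp add: add scale)
    qed (use a b in auto)
  qed
  then have sub: "convex hull S \<subseteq> ?H" using max by (intro hull_minimal) auto
  show ?thesis
    unfolding extreme_point_of_def
  proof (intro conjI ballI notI)
    show "x \<in> convex hull S" using x by (rule hull_inc)
    fix a b assume a: "a \<in> convex hull S" and b: "b \<in> convex hull S" and xab: "x \<in> open_segment a b"
    then obtain u where u: "0 < u" "u < 1" "a \<noteq> b" and xeq: "x = (1 - u) *\<^sub>R a + u *\<^sub>R b"
      unfolding in_segment by blast
    have "(1 - u) * \<phi> a + u * \<phi> b < \<phi> x"
      using a b sub u by (intro conv_le) auto
    moreover have "\<phi> x = (1 - u) * \<phi> a + u * \<phi> b"
      by (subst xeq) (simp add: add scale)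
    ultimately show False by simp
  qed
qed

definition choice_point :: "nat \<Rightarrow> (nat \<Rightarrow> nat) \<Rightarrow> (nat \<Rightarrow>\<^sub>0 real)" where
  "choice_point n c = (\<Sum>i<n. std_basis (c i))"

lemma sum_std_basis_images:
  "(\<Sum>i<n. std_basis ` L i) = choice_point n ` PiE {..<n} L"
proof (intro equalityI subsetI)
  fix v assume "v \<in> (\<Sum>i<n. std_basis ` L i)"
  then obtain f where v: "v = sum f {..<n}" and "\<forall>i<n. f i \<in> std_basis ` L i"
    by (auto simp: set_sum_alt)
  then have "\<forall>i\<in>{..<n}. \<exists>j. j \<in> L i \<and> f i = std_basis j" by auto
  then obtain c where c: "\<forall>i\<in>{..<n}. c i \<in> L i \<and> f i = std_basis (c i)"
    using bchoice[of "{..<n}" "\<lambda>i j. j \<in> L i \<and> f i = std_basis j"] by blast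
  have "v = choice_point n (restrict c {..<n})"
    unfolding v choice_point_def using c by (intro sum.cong) auto
  moreover have "restrict c {..<n} \<in> PiE {..<n} L" using c by auto
  ultimately show "v \<in> choice_point n ` PiE {..<n} L" by blast
next
  fix v assume "v \<in> choice_point n ` PiE {..<n} L"
  then obtain c where "c \<in> PiE {..<n} L" "v = (\<Sum>i<n. std_basis (c i))"
    by (auto simp: choice_point_def)
  then show "v \<in> (\<Sum>i<n. std_basis ` L i)"
    by (force simp: set_sum_alt)
qed

text \<open>Convex hulls commute with Minkowski sums. Hence extreme points of the sum can only be
  found among the choice points.\<close>

lemma sum_simplex_on:
  "(\<Sum>i<n. simplex_on (L i)) = convex hull (choice_point n ` PiE {..<n} L)"
  by (simp add: simplex_on_def convex_hull_set_sum flip: sum_std_basis_images)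

text \<open>A certificate of extremality: a linear functional is maximised on a Minkowski sum
  summand by summand, so such weights single out \<open>c\<close> among all choices.\<close>

definition strict_weight :: "nat \<Rightarrow> (nat \<Rightarrow> nat set) \<Rightarrow> (nat \<Rightarrow> nat) \<Rightarrow> (nat \<Rightarrow> real) \<Rightarrow> bool" where
  "strict_weight n L c w \<longleftrightarrow> (\<forall>i<n. \<forall>j\<in>L i. j \<noteq> c i \<longrightarrow> w j < w (c i))"

lemma weight_functional_choice_point_less:
  assumes fin: "\<And>i. i < n \<Longrightarrow> finite (L i)"
    and c: "c \<in> PiE {..<n} L" and c': "c' \<in> PiE {..<n} L" and "c' \<noteq> c"
    and w: "strict_weight n L c w"
  shows "weight_functional (\<Union>i<n. L i) w (choice_point n c')
       < weight_functional (\<Union>i<n. L i) w (choice_point n c)"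
proof -
  let ?\<phi> = "weight_functional (\<Union>i<n. L i) w"
  have eval: "?\<phi> (choice_point n d) = (\<Sum>i<n. w (d i))" if "d \<in> PiE {..<n} L" for d
  proof -
    have "?\<phi> (choice_point n d) = (\<Sum>i<n. ?\<phi> (std_basis (d i)))"
      unfolding choice_point_def by (rule linear_sum[OF linear_weight_functional])
    also have "\<dots> = (\<Sum>i<n. w (d i))"
      using that fin by (intro sum.cong refl weight_functional_std_basis) auto
    finally show ?thesis .
  qed
  obtain i where i: "i < n" "c' i \<noteq> c i"
    using PiE_ext[OF c' c] \<open>c' \<noteq> c\<close> by blast
  have le: "w (c' i) < w (c i)" if "i < n" "c' i \<noteq> c i" for i
    using that c' w unfolding strict_weight_def by auto
  have "(\<Sum>i<n. w (c' i)) < (\<Sum>i<n. w (c i))"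
  proof (rule sum_strict_mono_ex1)
    show "\<forall>i\<in>{..<n}. w (c' i) \<le> w (c i)" using le by (metis lessThan_iff less_eq_real_def)
    show "\<exists>i\<in>{..<n}. w (c' i) < w (c i)" using le i by blast
  qed simp
  then show ?thesis using eval c c' by simp
qed

lemma vertices_sum_simplex_on_choice_points:
  assumes "\<And>i. i < n \<Longrightarrow> finite (L i)"
    and "c \<in> PiE {..<n} L" and "strict_weight n L c w"
  shows "choice_point n c \<in> vertices (\<Sum>i<n. simplex_on (L i))"
proof -
  have "choice_point n c extreme_point_of (convex hull (choice_point n ` PiE {..<n} L))"
  proof (rule strict_max_extreme_point_of_convex_hull[OF linear_weight_functional])
    show "choice_point n c \<in> choice_point n ` PiE {..<n} L" using assms(2) by blast
    fix y assume "y \<in> choice_point n ` PiE {..<n} L" "y \<noteq> choice_point n c"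
    then show "weight_functional (\<Union>i<n. L i) w y
        < weight_functional (\<Union>i<n. L i) w (choice_point n c)"
      using weight_functional_choice_point_less[OF assms(1,2) _ _ assms(3)] by blast
  qed
  then show ?thesis by (simp add: vertices_def sum_simplex_on)
qed

text \<open>Different choices can have the same sum, for instance after swapping two values. A
  strict weight excludes this, so that counting choices counts vertices.\<close>

lemma choice_point_eq_imp_eq:
  assumes "\<And>i. i < n \<Longrightarrow> finite (L i)"
    and "c \<in> PiE {..<n} L" and "strict_weight n L c w"
    and "c' \<in> PiE {..<n} L" and "choice_point n c' = choice_point n c"
  shows "c' = c"
  using weight_functional_choice_point_less[OF assms(1,2,4) _ assms(3)] assms(5) by force

lemma choice_point_fun_upd:
  assumes "i < n"
  shows "choice_point n (c(i := a)) = choice_point n c - std_basis (c i) + std_basis a"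
proof -
  have "(\<Sum>l\<in>{..<n} - {i}. std_basis ((c(i := a)) l)) = (\<Sum>l\<in>{..<n} - {i}. std_basis (c l))"
    by (intro sum.cong) auto
  then show ?thesis
    unfolding choice_point_def
    using assms sum.remove[of "{..<n}" i "\<lambda>l. std_basis ((c(i := a)) l)"]
      sum.remove[of "{..<n}" i "\<lambda>l. std_basis (c l)"] by simp
qed

text \<open>Overwriting \<open>c i\<close> by \<open>c j\<close> in slot \<open>i\<close>, or
  \<open>c j\<close> by \<open>c i\<close> in slot \<open>j\<close>, moves the point by opposite
  nonzero vectors, so it is the midpoint of two other points of the polytope.\<close>

lemma choice_point_not_vertex:
  assumes c: "c \<in> PiE {..<n} L" and ij: "i < n" "j < n"
    and ne: "c i \<noteq> c j" and L: "c i \<in> L j" "c j \<in> L i"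
  shows "choice_point n c \<notin> vertices (\<Sum>i<n. simplex_on (L i))"
proof
  assume "choice_point n c \<in> vertices (\<Sum>i<n. simplex_on (L i))"
  then have ext: "choice_point n c extreme_point_of (convex hull (choice_point n ` PiE {..<n} L))"
    by (simp add: vertices_def sum_simplex_on)
  define p where "p = choice_point n (c(i := c j))"
  define q where "q = choice_point n (c(j := c i))"
  have p: "p = choice_point n c - std_basis (c i) + std_basis (c j)"
    and q: "q = choice_point n c - std_basis (c j) + std_basis (c i)"
    unfolding p_def q_def using ij by (simp_all add: choice_point_fun_upd)
  have "c(i := c j) \<in> PiE {..<n} L" "c(j := c i) \<in> PiE {..<n} L"
    using c ij L by (auto simp: PiE_iff extensional_def)
  then have "p \<in> convex hull (choice_point n ` PiE {..<n} L)"
    "q \<in> convex hull (choice_point n ` PiE {..<n} L)"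
    unfolding p_def q_def by (auto intro: hull_inc)
  moreover have "p \<noteq> q"
  proof
    assume "p = q"
    then have "std_basis (c j) + std_basis (c j) = std_basis (c i) + std_basis (c i)"
      unfolding p q by (simp add: algebra_simps)
    then have "Poly_Mapping.lookup (std_basis (c j) + std_basis (c j)) (c j)
             = Poly_Mapping.lookup (std_basis (c i) + std_basis (c i)) (c j)" by simp
    then show False using ne by (simp only: lookup_add std_basis_def lookup_single) simp
  qed
  moreover have "midpoint p q = choice_point n c"
  proof -
    have "p + q = 2 *\<^sub>R choice_point n c" unfolding p q by (simp add: scaleR_2)
    then show ?thesis by (simp add: midpoint_def)
  qed
  ultimately show False
    using ext midpoint_in_open_segment[of p q] unfolding extreme_point_of_def by force
qed

subsection \<open>Overlapping intervals\<close>

text \<open>Constraining neighbours suffices when \<open>k \<le> 2 * s\<close>, since intervals two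
  or more steps apart are then disjoint. Extensional functions carry no data outside
  \<open>{..<n}\<close>, so the set can be counted.\<close>

definition compatible_choices :: "nat \<Rightarrow> nat \<Rightarrow> nat \<Rightarrow> (nat \<Rightarrow> nat) set" where
  "compatible_choices k s n = {c \<in> PiE {..<n} (lam_set k s).
     \<forall>i. Suc i < n \<longrightarrow> c i \<in> lam_set k s (Suc i) \<longrightarrow> c (Suc i) \<in> lam_set k s i \<longrightarrow> c i = c (Suc i)}"

text \<open>
  Since \<open>k \<le> 2 s\<close>, only the last two intervals reach the coordinates \<open>\<ge> s n\<close>, so the weights there
  can be reset relative to the weight of the previous choice.
\<close>

lemma ex_strict_weight:
  assumes "k \<le> 2 * s" and "c \<in> compatible_choices k s n"
  shows "\<exists>w. strict_weight n (lam_set k s) c w"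
  using assms(2)
proof (induction n arbitrary: c)
  case 0
  then show ?case by (simp add: strict_weight_def)
next
  case (Suc n)
  show ?case
  proof (cases n)
    case 0
    have "strict_weight (Suc n) (lam_set k s) c (\<lambda>j. if j = c 0 then 1 else 0)"
      by (auto simp: strict_weight_def 0)
    then show ?thesis by blast
  next
    case n: (Suc m)
    have cin: "\<And>i. i \<le> n \<Longrightarrow> c i \<in> lam_set k s i"
      and cc: "\<And>i. i < n \<Longrightarrow> c i \<in> lam_set k s (Suc i) \<Longrightarrow> c (Suc i) \<in> lam_set k s i
                 \<Longrightarrow> c i = c (Suc i)"
      using Suc.prems by (auto simp: compatible_choices_def)
    have "restrict c {..<n} \<in> compatible_choices k s n"
      using cin cc by (auto simp: compatible_choices_def)
    then obtain w where "strict_weight n (lam_set k s) (restrict c {..<n}) w"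
      using Suc.IH by blast
    then have w: "\<And>i j. i < n \<Longrightarrow> j \<in> lam_set k s i \<Longrightarrow> j \<noteq> c i \<Longrightarrow> w j < w (c i)"
      by (auto simp: strict_weight_def)
    define M where "M = w (c m)"
    \<comment> \<open>The weight of \<open>c m\<close> stays \<open>M\<close>, and unchosen
      coordinates from \<open>s * n\<close> on drop to \<open>M - 2\<close>. If
      \<open>c m < s * n\<close>, then \<open>c n\<close> may lie in the previous interval and must
      stay below \<open>M\<close>. Otherwise \<open>c m\<close> lies in the last interval too, and a
      different \<open>c n\<close> must beat it; this is harmless, as \<open>c n\<close> is then
      outside the previous interval.\<close>
    define w' where "w' j = (if j < s * n then w j else if j = c m then M
      else if j = c n then (if c m < s * n then M - 1 else M + 1) else M - 2)" for j
    have cm: "s * m \<le> c m" "c m < s * m + k" and cn: "s * n \<le> c n" "c n < s * n + k"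
      using cin[of m] cin[of n] n by (auto simp: lam_set_def)
    \<comment> \<open>Intervals before the \<open>m\<close>-th end at or below \<open>s * n\<close>,
      so their weights are untouched.\<close>
    have early: "j < s * n" if "i < m" "j \<in> lam_set k s i" for i j
    proof -
      have "s * Suc i \<le> s * m" using that by (intro mult_le_mono2) auto
      then show ?thesis using that assms(1) n by (auto simp: lam_set_def)
    qed
    have ccm: "c m = c n" if "s * n \<le> c m" "c n < s * m + k"
      using that cc[of m] cm cn n by (auto simp: lam_set_def)
    have "w' j < w' (c i)" if ij: "i < Suc n" "j \<in> lam_set k s i" "j \<noteq> c i" for i j
    proof -
      consider "i < m" | "i = m" | "i = n" using ij(1) n by linarith
      then show ?thesis
      proof cases
        case 1
        then have "j < s * n" "c i < s * n" "w j < w (c i)"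
          using early that cin[of i] w n by auto
        then show ?thesis by (simp add: w'_def)
      next
        case 2
        have "w' (c m) = M" by (simp add: w'_def M_def)
        moreover have "w' j < M"
        proof (cases "j < s * n")
          case True
          then show ?thesis using w[of m j] that 2 n by (simp add: w'_def M_def)
        next
          case False
          \<comment> \<open>The only danger is \<open>j = c n\<close> with weight
            \<open>M + 1\<close>; but then \<open>s * n \<le> c m\<close> and \<open>c n\<close>
            lies in the \<open>m\<close>-th interval, so \<open>ccm\<close> forces
            \<open>j = c m\<close>.\<close>
          then show ?thesis using that 2 ccm by (auto simp: w'_def lam_set_def)
        qed
        ultimately show ?thesis using 2 by simp
      next
        case 3
        then have "s * n \<le> j" using that by (simp add: lam_set_def)
        then show ?thesis using 3 that cn by (auto simp: w'_def)
      qed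
    qed
    then show ?thesis unfolding strict_weight_def by blast
  qed
qed

text \<open>Strict weights serve twice: they make \<open>choice_point\<close> injective on
  compatible choices and its values vertices. The midpoint argument shows that no other choice
  yields a vertex.\<close>

lemma num_vertices_eq_card_compatible_choices:
  assumes "k \<le> 2 * s"
  shows "num_vertices k s n = card (compatible_choices k s n)"
proof -
  have fin: "\<And>i. finite (lam_set k s i)" by (simp add: lam_set_def)
  have sub: "compatible_choices k s n \<subseteq> PiE {..<n} (lam_set k s)"
    by (auto simp: compatible_choices_def)
  have "inj_on (choice_point n) (compatible_choices k s n)"
  proof (rule inj_onI)
    fix c c' assume "c \<in> compatible_choices k s n" "c' \<in> compatible_choices k s n"
      "choice_point n c = choice_point n c'"
    then show "c = c'"
      using ex_strict_weight[OF assms] choice_point_eq_imp_eq[of n "lam_set k s" c'] fin sub by blast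
  qed
  moreover have "vertices (minkowski_polytope n k s) = choice_point n ` compatible_choices k s n"
  proof (intro equalityI subsetI)
    fix v assume v: "v \<in> vertices (minkowski_polytope n k s)"
    then have "v extreme_point_of (convex hull (choice_point n ` PiE {..<n} (lam_set k s)))"
      by (simp add: vertices_def minkowski_polytope_def sum_simplex_on)
    then obtain c where c: "c \<in> PiE {..<n} (lam_set k s)" "v = choice_point n c"
      using extreme_point_of_convex_hull by blast
    have "c i = c (Suc i)"
      if "Suc i < n" "c i \<in> lam_set k s (Suc i)" "c (Suc i) \<in> lam_set k s i" for i
      using choice_point_not_vertex[OF c(1), of i "Suc i"] that v c(2)
      by (auto simp: minkowski_polytope_def)
    then have "c \<in> compatible_choices k s n" using c(1) by (auto simp: compatible_choices_def)
    then show "v \<in> choice_point n ` compatible_choices k s n" using c(2) by blast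
  next
    fix v assume "v \<in> choice_point n ` compatible_choices k s n"
    then obtain c where c: "c \<in> compatible_choices k s n" and "v = choice_point n c" by blast
    then show "v \<in> vertices (minkowski_polytope n k s)"
      using ex_strict_weight[OF assms c] vertices_sum_simplex_on_choice_points[of n "lam_set k s" c]
        fin sub unfolding minkowski_polytope_def by blast
  qed
  ultimately show ?thesis by (simp add: num_vertices_def card_image)
qed

subsection \<open>Counting compatible choices\<close>

lemma finite_compatible_choices: "finite (compatible_choices k s n)"
  by (rule finite_subset[of _ "PiE {..<n} (lam_set k s)"])
    (auto simp: compatible_choices_def lam_set_def intro!: finite_PiE)

text \<open>The empty choice supplies the constant term of the generating function and lets the
  recurrence start at index 0.\<close>

lemma card_compatible_choices_0: "card (compatible_choices k s 0) = 1"
  by (simp add: compatible_choices_def)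

lemma card_compatible_choices_1: "card (compatible_choices k s 1) = k"
proof -
  have "compatible_choices k s 1 = PiE {..<1} (lam_set k s)"
    by (auto simp: compatible_choices_def)
  then show ?thesis by (simp add: card_PiE lam_set_def)
qed

text \<open>The map \<open>f\<close> appends a value and is a bijection onto the disjoint union of
  the compatible choices and \<open>bad\<close>; \<open>g\<close> parametrises \<open>bad\<close>.
  The additive form keeps the identity in the naturals, and for \<open>k = s\<close> the truncated
  \<open>k - s - 1\<close> is multiplied by 0.\<close>

lemma card_compatible_choices_rec:
  assumes "k \<le> 2 * s" and "s \<le> k"
  shows "card (compatible_choices k s (Suc (Suc n)))
       + (k - s) * (k - s - 1) * card (compatible_choices k s n)
       = k * card (compatible_choices k s (Suc n))"
proof -
  let ?G = "compatible_choices k s" and ?L = "lam_set k s"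
  define I where "I = ?L n \<inter> ?L (Suc n)"
  define D where "D = {(a, b). a \<in> I \<and> b \<in> I \<and> a \<noteq> b}"
  define f where "f = (\<lambda>(c :: nat \<Rightarrow> nat, y). c(Suc n := y))"
  define g where "g = (\<lambda>(c :: nat \<Rightarrow> nat, a, b). c(n := a, Suc n := b))"
  define bad where "bad = g ` (?G n \<times> D)"
  have Ieq: "I = {s * Suc n ..< s * n + k}" by (auto simp: I_def lam_set_def)
  have finD: "finite D" and cardD: "card D = (k - s) * (k - s - 1)"
  proof -
    have "D = Sigma I (\<lambda>a. I - {a})" by (auto simp: D_def)
    moreover have "finite I" "card I = k - s" by (simp_all add: Ieq)
    ultimately show "finite D" "card D = (k - s) * (k - s - 1)" by simp_all
  qed
  \<comment> \<open>The positions overwritten by \<open>f\<close> and \<open>g\<close> held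
    \<open>undefined\<close> before, so overwriting loses nothing; this gives injectivity.\<close>
  have und: "c i = undefined" if "c \<in> ?G m" "i \<ge> m" for c m i
    using that by (auto simp: compatible_choices_def PiE_iff extensional_def)
  have inj_f: "inj_on f (?G (Suc n) \<times> ?L (Suc n))"
  proof (rule inj_onI, clarsimp simp: f_def)
    fix c y c' y' assume c: "c \<in> ?G (Suc n)" "c' \<in> ?G (Suc n)" and eq: "c(Suc n := y) = c'(Suc n := y')"
    have "c i = c' i" for i
      using fun_cong[OF eq, of i] und[OF c(1), of i] und[OF c(2), of i] by (cases "i = Suc n") auto
    then show "c = c' \<and> y = y'" using fun_cong[OF eq, of "Suc n"] by auto
  qed
  have inj_g: "inj_on g (?G n \<times> D)"
  proof (rule inj_onI, clarsimp simp: g_def)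
    fix c a b c' a' b' assume c: "c \<in> ?G n" "c' \<in> ?G n"
      and eq: "c(n := a, Suc n := b) = c'(n := a', Suc n := b')"
    have "c i = c' i" for i
      using fun_cong[OF eq, of i] und[OF c(1), of i] und[OF c(2), of i]
      by (cases "i = n \<or> i = Suc n") auto
    then show "c = c' \<and> a = a' \<and> b = b'"
      using fun_cong[OF eq, of n] fun_cong[OF eq, of "Suc n"] by auto
  qed
  have restr: "restrict c {..<m} \<in> ?G m" if "c \<in> ?G (Suc m)" for c m
    using that by (auto simp: compatible_choices_def)
  have disj: "?G (Suc (Suc n)) \<inter> bad = {}"
    by (auto simp: bad_def g_def D_def I_def compatible_choices_def)
  have "f ` (?G (Suc n) \<times> ?L (Suc n)) = ?G (Suc (Suc n)) \<union> bad"
  proof (intro equalityI subsetI)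
    fix h assume "h \<in> f ` (?G (Suc n) \<times> ?L (Suc n))"
    then obtain c y where c: "c \<in> ?G (Suc n)" and y: "y \<in> ?L (Suc n)" and h: "h = c(Suc n := y)"
      by (auto simp: f_def)
    show "h \<in> ?G (Suc (Suc n)) \<union> bad"
    proof (cases "(c n, y) \<in> D")
      case True
      have "h = g (restrict c {..<n}, c n, y)"
      proof
        fix i show "h i = g (restrict c {..<n}, c n, y) i"
          using und[OF c, of i] by (auto simp: h g_def)
      qed
      then show ?thesis using restr[OF c] True by (auto simp: bad_def)
    next
      case False
      have "h \<in> PiE {..<Suc (Suc n)} ?L"
        using c y by (auto simp: h compatible_choices_def PiE_iff extensional_def less_Suc_eq)
      moreover have "h i = h (Suc i)"
        if "Suc i < Suc (Suc n)" "h i \<in> ?L (Suc i)" "h (Suc i) \<in> ?L i" for i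
      proof (cases "i = n")
        case True
        have "c n \<in> ?L n" using c by (auto simp: compatible_choices_def)
        then show ?thesis using that True False y by (auto simp: h D_def I_def)
      next
        case False
        then show ?thesis using that c by (auto simp: h compatible_choices_def)
      qed
      ultimately show ?thesis by (auto simp: compatible_choices_def)
    qed
  next
    fix h assume "h \<in> ?G (Suc (Suc n)) \<union> bad"
    then show "h \<in> f ` (?G (Suc n) \<times> ?L (Suc n))"
    proof
      assume h: "h \<in> ?G (Suc (Suc n))"
      have "h = f (restrict h {..<Suc n}, h (Suc n))"
      proof
        fix i show "h i = f (restrict h {..<Suc n}, h (Suc n)) i"
          using und[OF h, of i] by (auto simp: f_def)
      qed
      moreover have "h (Suc n) \<in> ?L (Suc n)" using h by (auto simp: compatible_choices_def)
      ultimately show ?thesis using restr[OF h] by blast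
    next
      assume "h \<in> bad"
      then obtain c a b where c: "c \<in> ?G n" and ab: "(a, b) \<in> D" and h: "h = c(n := a, Suc n := b)"
        by (auto simp: bad_def g_def)
      have a: "a \<in> ?L n" "b \<in> ?L (Suc n)" "s * Suc n \<le> a" using ab by (auto simp: D_def I_def lam_set_def)
      have "c(n := a) \<in> PiE {..<Suc n} ?L"
        using c a by (auto simp: compatible_choices_def PiE_iff extensional_def less_Suc_eq)
      moreover have "(c(n := a)) i = (c(n := a)) (Suc i)"
        if i: "Suc i < Suc n" and *: "(c(n := a)) i \<in> ?L (Suc i)" "(c(n := a)) (Suc i) \<in> ?L i" for i
      proof (cases "Suc i = n")
        case True
        then have "a \<in> ?L i" using * by simp
        \<comment> \<open>As \<open>k \<le> 2 * s\<close>, the overlap of intervals \<open>n\<close>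
          and \<open>Suc n\<close> starts beyond interval \<open>n - 1\<close>. Appending
          \<open>a\<close> thus creates no conflict with the preceding value, whatever
          \<open>c\<close> is.\<close>
        then have False using a(3) True assms(1) by (auto simp: lam_set_def)
        then show ?thesis ..
      next
        case False
        then show ?thesis using i * c by (auto simp: compatible_choices_def)
      qed
      ultimately have "c(n := a) \<in> ?G (Suc n)" by (auto simp: compatible_choices_def)
      moreover have "h = f (c(n := a), b)" by (simp add: h f_def)
      ultimately show ?thesis using a by blast
    qed
  qed
  then have "card (?G (Suc (Suc n)) \<union> bad) = card (?G (Suc n)) * k"
    using card_image[OF inj_f] by (simp add: card_cartesian_product lam_set_def)
  moreover have "card bad = card (?G n) * card D"
    unfolding bad_def using card_image[OF inj_g] by (simp add: card_cartesian_product)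
  moreover have "finite bad"
    unfolding bad_def by (simp add: finite_compatible_choices finD)
  ultimately show ?thesis
    using disj cardD by (simp add: card_Un_disjoint finite_compatible_choices mult.commute)
qed

subsection \<open>Second-order linear recurrences\<close>

text \<open>In the product with the denominator, coefficients from index 2 on vanish by the
  recurrence, and the one at index 1 vanishes because \<open>b 1 = p * b 0\<close>.\<close>

lemma fps_of_linear_recurrence2:
  fixes b :: "nat \<Rightarrow> 'a::field"
  assumes "b 0 = 1" "b 1 = p" and rec: "\<And>n. b (n + 2) = p * b (n + 1) - q * b n"
  shows "Abs_fps b = 1 / (1 - fps_const p * fps_X + fps_const q * fps_X ^ 2)"
proof -
  let ?Q = "1 - fps_const p * fps_X + fps_const q * fps_X ^ 2"
  have "Abs_fps b * ?Q = 1"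
  proof (rule fps_ext)
    fix n :: nat
    have expand: "Abs_fps b * ?Q = Abs_fps b - fps_const p * (fps_X * Abs_fps b)
        + fps_const q * (fps_X ^ 2 * Abs_fps b)"
      by (simp add: algebra_simps)
    consider "n = 0" | "n = 1" | m where "n = m + 2"
      by (metis One_nat_def add_2_eq_Suc' not0_implies_Suc)
    then show "fps_nth (Abs_fps b * ?Q) n = fps_nth 1 n"
    proof cases
      case 3
      then show ?thesis using expand rec[of m] by (simp add: fps_X_power_mult_nth)
    qed (use expand assms(1,2) in \<open>simp_all add: fps_X_power_mult_nth\<close>)
  qed
  then have "inverse ?Q = Abs_fps b" by (intro fps_inverse_unique) (simp add: mult.commute)
  moreover have "fps_nth ?Q 0 \<noteq> 0" by simp
  ultimately show ?thesis by (metis fps_divide_unit mult_1)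
qed

text \<open>The numbers \<open>p + D\<close> and \<open>p - D\<close> are twice the roots of the
  characteristic polynomial, whence the power of 2; \<open>pos\<close> makes them distinct.\<close>

lemma linear_recurrence2_closed_form:
  fixes b :: "nat \<Rightarrow> real"
  assumes "b 0 = 1" "b 1 = p" and rec: "\<And>n. b (n + 2) = p * b (n + 1) - q * b n"
    and pos: "p ^ 2 - 4 * q > 0"
  defines "D \<equiv> sqrt (p ^ 2 - 4 * q)"
  shows "b n = 1 / 2 ^ (n + 1) * ((p - D) ^ n + (p + D) ^ n
           + 2 * p / ((p + D) - (p - D)) * ((p + D) ^ n - (p - D) ^ n))"
proof -
  have D: "D > 0" "D ^ 2 = p ^ 2 - 4 * q" using pos by (auto simp: D_def)
  \<comment> \<open>This is the bracket of the claim with its fraction reduced to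
    \<open>p / D\<close>; the coefficients fit \<open>h 0 = 2\<close> and
    \<open>h 1 = 4 * p\<close>.\<close>
  define h where "h n = (p - D) ^ n + (p + D) ^ n + p / D * ((p + D) ^ n - (p - D) ^ n)" for n
  have sq: "x ^ (n + 2) = 2 * p * x ^ (n + 1) - 4 * q * x ^ n"
    if "x = p + D \<or> x = p - D" for x n
  proof -
    have x2: "x ^ 2 = 2 * p * x - 4 * q" using that D(2) by (auto simp: power2_eq_square algebra_simps)
    have "x ^ (n + 2) = x ^ 2 * x ^ n" by (simp add: power_add power2_eq_square)
    also have "\<dots> = 2 * p * x ^ (n + 1) - 4 * q * x ^ n" unfolding x2 by (simp add: algebra_simps)
    finally show ?thesis .
  qed
  have h_rec: "h (n + 2) = 2 * p * h (n + 1) - 4 * q * h n" for n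
    unfolding h_def by (simp only: sq[OF disjI1[OF refl]] sq[OF disjI2[OF refl]]) (simp add: algebra_simps)
  have "2 ^ (n + 1) * b n = h n \<and> 2 ^ (n + 2) * b (n + 1) = h (n + 1)" for n
  proof (induction n)
    case 0
    then show ?case using assms(1,2) D(1) by (simp add: h_def field_simps)
  next
    case (Suc n)
    have "2 ^ (n + 3) * b (n + 2) = 2 * p * (2 ^ (n + 2) * b (n + 1)) - 4 * q * (2 ^ (n + 1) * b n)"
      by (simp only: rec) (simp add: algebra_simps power_add)
    also have "\<dots> = h (n + 2)" using Suc.IH h_rec by simp
    finally show ?case using Suc.IH by (simp add: numeral_eq_Suc)
  qed
  then have "b n = 1 / 2 ^ (n + 1) * h n" by (simp add: field_simps)
  then show ?thesis by (simp add: h_def)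
qed

section \<open>Generating function, recurrence and closed form of the vertex numbers\<close>

theorem theorem4p2:
  fixes k s :: nat
  assumes "k \<ge> 1" and "s \<ge> 1"
    and "s \<in> {nat \<lceil>real k / 2\<rceil>..k}"
  shows "1 + Abs_fps (\<lambda>n. if n \<ge> 1 then real (num_vertices k s n) else 0)
      = 1 / (1 - fps_const (real k) * fps_X
               + fps_const ((real k - real s) * (real k - real s - 1)) * fps_X ^ 2)
    \<and> (\<forall>n\<ge>2. real (num_vertices k s (n + 2)) - real k * real (num_vertices k s (n + 1))
      + (real k - real s) * (real k - real s - 1) * real (num_vertices k s n) = 0)
    \<and> num_vertices k s 1 = k
    \<and> real (num_vertices k s 2) = real k ^ 2 - (real k - real s) * (real k - real s - 1)
    \<and> (let D = sqrt (real k ^ 2 - 4 * (real k - real s) * (real k - real s - 1));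
             w_plus = real k + D;
             w_minus = real k - D
         in \<forall>n\<ge>1. real (num_vertices k s n) = 1 / 2 ^ (n + 1) *
              (w_minus ^ n + w_plus ^ n
                + 2 * real k / (w_plus - w_minus) * (w_plus ^ n - w_minus ^ n)))"
proof -
  have sk: "s \<le> k" and ks: "k \<le> 2 * s" using assms(3) by auto
  define b where "b n = real (num_vertices k s n)" for n
  define q where "q = (real k - real s) * (real k - real s - 1)"
  \<comment> \<open>For \<open>k = s\<close> the natural and real second factors differ, but both
    products are 0.\<close>
  have q_nat: "q = real ((k - s) * (k - s - 1))"
    using sk by (cases "k = s") (auto simp: q_def of_nat_diff)
  have b0: "b 0 = 1" and nv1: "num_vertices k s 1 = k"
    by (simp_all only: b_def num_vertices_eq_card_compatible_choices[OF ks]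
        card_compatible_choices_0 card_compatible_choices_1 of_nat_1)
  then have b1: "b 1 = real k" by (simp add: b_def)
  have rec: "b (n + 2) = real k * b (n + 1) - q * b n" for n
    using arg_cong[OF card_compatible_choices_rec[OF ks sk, of n], of real]
    by (simp add: b_def q_nat num_vertices_eq_card_compatible_choices[OF ks])
  \<comment> \<open>For \<open>k \<noteq> s\<close>, \<open>4 * q\<close> is
    \<open>(2 * (k - s)) ^ 2\<close> minus the positive number \<open>4 * (k - s)\<close>, and
    \<open>2 * (k - s) \<le> k\<close>.\<close>
  have disc: "real k ^ 2 - 4 * q > 0"
  proof (cases "k = s")
    case True
    then show ?thesis using assms(1) by (simp add: q_def)
  next
    case False
    have "(2 * (real k - real s)) ^ 2 \<le> real k ^ 2" using sk ks by (intro power_mono) auto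
    moreover have "real k - real s > 0" using False sk by simp
    ultimately show ?thesis by (simp add: q_def power2_eq_square algebra_simps)
  qed
  have "1 + Abs_fps (\<lambda>n. if n \<ge> 1 then real (num_vertices k s n) else 0) = Abs_fps b"
  proof (rule fps_ext)
    fix n
    show "fps_nth (1 + Abs_fps (\<lambda>n. if n \<ge> 1 then real (num_vertices k s n) else 0)) n
        = fps_nth (Abs_fps b) n"
      using b0 by (cases n) (auto simp: b_def)
  qed
  also have "\<dots> = 1 / (1 - fps_const (real k) * fps_X + fps_const q * fps_X ^ 2)"
    using b0 b1 rec by (rule fps_of_linear_recurrence2)
  finally have "1 + Abs_fps (\<lambda>n. if n \<ge> 1 then real (num_vertices k s n) else 0)
      = 1 / (1 - fps_const (real k) * fps_X + fps_const q * fps_X ^ 2)" .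
  moreover have "b 2 = real k ^ 2 - q" using rec[of 0] b0 b1 by (simp add: power2_eq_square numeral_2_eq_2)
  moreover note linear_recurrence2_closed_form[of b, OF b0 b1 rec disc]
  ultimately show ?thesis
    using nv1 rec by (simp del: left_diff_distrib_numeral right_diff_distrib_numeral
        add: b_def q_def Let_def mult.assoc)
qed

end
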